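(* Let $m\geq1$ and $k=\lceil m/2\rceil$. Inside the $m\times\infty$ table, we have $$\mathcal{M}_m(k-a)\,\mathcal{I}_m(n)=2\bigl(\mathcal{M}_m(k-1)+\cdots+\mathcal{M}_m(1)+1\bigr)\mathcal{C}(n,a)$$ for all $a=1,\ldots,k$ and $n\geq1$. In particular, for $a=k$, we have $$\mathcal{I}_m(n)=\frac{2}{\mathcal{M}_m(0)}\bigl(\mathcal{M}_m(k-1)+\cdots+\mathcal{M}_m(1)+1\bigr)\mathcal{C}(n,k)$$ for all $n\geq1$.
   Context: Table: for an integer $m\geq1$, define $\mathcal{C}(x,y)=\mathcal{C}_m(x,y)$ for $x\geq1$, $1\leq y\leq m$, as the number of lattice paths (sequences of cells of the $m\times\infty$ table with steps in $\{(1,-1),(1,0),(1,1)\}$, first coordinate being the column) from any cell of the first column to the cell $(x,y)$. Equivalently, $\mathcal{C}(1,y)=1$ and $\mathcal{C}(x+1,y)=\mathcal{C}(x,y-1)+\mathcal{C}(x,y)+\mathcal{C}(x,y+1)$, with $\mathcal{C}(x,0)=\mathcal{C}(x,m+1)=0$. The $n$th column sum is $\mathcal{I}_m(n)=\mathcal{C}(n,1)+\cdots+\mathcal{C}(n,m)$. Multipliers: $\Delta$ is the difference operator, $\Delta a(n)=a(n+1)-a(n)$ for a sequence $\{a(n)\}$. $\mathcal{M}_m(n)$, $n\geq0$, are polynomials in $\Delta$ defined by $\mathcal{M}_m(0)=2$ if $m$ is odd and $\mathcal{M}_m(0)=1$ if $m$ is even, $\mathcal{M}_m(1)=\Delta-2+\mathcal{M}_m(0)$,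 and $\mathcal{M}_m(n+2)=\Delta\mathcal{M}_m(n+1)-\mathcal{M}_m(n)$ for all $n\geq0$. They act on $\mathcal{C}(n,i)$ with respect to the variable $n$ (with $i$ fixed), i.e. $\Delta\mathcal{C}(n,i)=\mathcal{C}(n+1,i)-\mathcal{C}(n,i)$, and on $\mathcal{I}_m(n)$ with respect to $n$. For $k=1$ the sum $\mathcal{M}_m(k-1)+\cdots+\mathcal{M}_m(1)$ is empty. *)

theory Defs
  imports Complex_Main "HOL-Library.Product_Plus" "HOL-Computational_Algebra.Polynomial"
begin

text \<open>Cells are pairs (column, row).\<close>

definition table :: "nat \<Rightarrow> (int \<times> int) set" where
  "table m = {(x, y). 1 \<le> x \<and> 1 \<le> y \<and> y \<le> int m}"

definition lattice_paths :: "nat \<Rightarrow> int \<times> int \<Rightarrow> (int \<times> int) list set" where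
  "lattice_paths m c =
     {p. p \<noteq> [] \<and> set p \<subseteq> table m \<and> fst (hd p) = 1 \<and> last p = c \<and>
         successively (\<lambda>u v. v - u \<in> {(1, -1), (1, 0), (1, 1)}) p}"

definition path_count :: "nat \<Rightarrow> nat \<Rightarrow> nat \<Rightarrow> nat" where
  "path_count m x y = card (lattice_paths m (int x, int y))"

definition column_sum :: "nat \<Rightarrow> nat \<Rightarrow> nat" where
  "column_sum m n = (\<Sum>y = 1..m. path_count m n y)"

definition forward_diff :: "(nat \<Rightarrow> rat) \<Rightarrow> nat \<Rightarrow> rat" where
  "forward_diff a n = a (Suc n) - a n"

text \<open>A polynomial acts on sequences with its variable interpreted as the difference operator.\<close>

definition diff_action :: "rat poly \<Rightarrow> (nat \<Rightarrow> rat) \<Rightarrow> nat \<Rightarrow> rat" where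
  "diff_action p a n = (\<Sum>i\<le>degree p. coeff p i * (forward_diff ^^ i) a n)"

definition multiplier0 :: "nat \<Rightarrow> rat" where
  "multiplier0 m = (if odd m then 2 else 1)"

text \<open>The polynomial variable \<open>[:0, 1:]\<close> stands for the difference operator.\<close>

fun multiplier :: "nat \<Rightarrow> nat \<Rightarrow> rat poly" where
  "multiplier m 0 = [:multiplier0 m:]"
| "multiplier m (Suc 0) = [:0, 1:] - 2 + multiplier m 0"
| "multiplier m (Suc (Suc n)) = [:0, 1:] * multiplier m (Suc n) - multiplier m n"

lemma lattice_paths_outside: "c \<notin> table m \<Longrightarrow> lattice_paths m c = {}"
  unfolding lattice_paths_def using last_in_set by fastforce

lemma path_count_0 [simp]: "path_count m x 0 = 0"
  by (simp add: path_count_def lattice_paths_outside table_def)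

lemma path_count_Suc_m [simp]: "path_count m x (Suc m) = 0"
  by (simp add: path_count_def lattice_paths_outside table_def)

lemma lattice_paths_snoc:
  assumes "c \<in> table m" and "fst c \<noteq> 1"
  shows "lattice_paths m c =
    (\<lambda>p. p @ [c]) ` (\<Union>d \<in> {(1, -1), (1, 0), (1, 1)}. lattice_paths m (c - d))"
proof (intro equalityI subsetI)
  fix p assume p: "p \<in> lattice_paths m c"
  then have ne: "p \<noteq> []" and l: "last p = c" and h: "fst (hd p) = 1"
    by (auto simp: lattice_paths_def)
  define q where "q = butlast p"
  have pq: "p = q @ [c]" using ne l by (metis q_def append_butlast_last_id)
  have q: "q \<noteq> []" using pq h assms by auto
  have s: "c - last q \<in> {(1, -1), (1, 0), (1, 1)}"
    and "q \<in> lattice_paths m (last q)"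
    using p q unfolding pq lattice_paths_def by (auto simp: successively_append_iff)
  then have "q \<in> lattice_paths m (c - (c - last q))" by simp
  then show "p \<in> (\<lambda>p. p @ [c]) ` (\<Union>d \<in> {(1, -1), (1, 0), (1, 1)}. lattice_paths m (c - d))"
    using s pq by blast
next
  fix p assume "p \<in> (\<lambda>p. p @ [c]) ` (\<Union>d \<in> {(1, -1), (1, 0), (1, 1)}. lattice_paths m (c - d))"
  then obtain q d where "p = q @ [c]" "d \<in> {(1, -1), (1, 0), (1, 1)}"
    "q \<in> lattice_paths m (c - d)" by blast
  then show "p \<in> lattice_paths m c"
    using assms by (auto simp: lattice_paths_def successively_append_iff)
qed

lemma lattice_paths_column_1:
  assumes "1 \<le> y" and "y \<le> int m"
  shows "lattice_paths m (1, y) = {[(1, y)]}"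
proof (intro equalityI subsetI)
  fix p assume p: "p \<in> lattice_paths m (1, y)"
  define q where "q = butlast p"
  have pq: "p = q @ [(1, y)]"
    using p unfolding q_def lattice_paths_def by (metis (lifting) append_butlast_last_id mem_Collect_eq)
  have "q = []"
  proof (rule ccontr)
    assume q: "q \<noteq> []"
    then have "(1, y) - last q \<in> {(1, -1), (1, 0), (1, 1)}" "last q \<in> table m"
      using p unfolding pq lattice_paths_def by (auto simp: successively_append_iff)
    then show False by (cases "last q") (auto simp: table_def)
  qed
  then show "p \<in> {[(1, y)]}" using pq by simp
qed (use assms in \<open>auto simp: lattice_paths_def table_def\<close>)

lemma path_count_1: "1 \<le> y \<Longrightarrow> y \<le> m \<Longrightarrow> path_count m (Suc 0) y = 1"
  by (simp add: path_count_def lattice_paths_column_1)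

lemma finite_lattice_paths: "finite (lattice_paths m (int x, y))"
proof (induction x arbitrary: y)
  case 0
  show ?case by (simp add: lattice_paths_outside table_def)
next
  case (Suc x)
  show ?case
  proof (cases "(int (Suc x), y) \<in> table m")
    case True
    show ?thesis
    proof (cases "x = 0")
      case True
      then show ?thesis using \<open>_ \<in> table m\<close> by (simp add: table_def lattice_paths_column_1)
    next
      case False
      then show ?thesis using True Suc by (simp add: lattice_paths_snoc)
    qed
  qed (simp add: lattice_paths_outside)
qed

lemma path_count_Suc:
  assumes "1 \<le> x" and "1 \<le> y" and "y \<le> m"
  shows "path_count m (Suc x) y =
    path_count m x (y - 1) + path_count m x y + path_count m x (y + 1)"
proof -
  let ?L = "\<lambda>z. lattice_paths m (int x, z)"
  have "lattice_paths m (int (Suc x), int y) =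
      (\<lambda>p. p @ [(int (Suc x), int y)]) ` (?L (int y + 1) \<union> (?L (int y) \<union> ?L (int y - 1)))"
    using assms by (subst lattice_paths_snoc) (auto simp: table_def)
  then have "path_count m (Suc x) y = card (?L (int y + 1) \<union> (?L (int y) \<union> ?L (int y - 1)))"
    by (simp add: path_count_def card_image inj_on_def)
  also have "\<dots> = card (?L (int y + 1)) + (card (?L (int y)) + card (?L (int y - 1)))"
  proof -
    have "?L u \<inter> ?L v = {}" if "u \<noteq> v" for u v
      using that by (auto simp: lattice_paths_def)
    then show ?thesis
      by (simp add: card_Un_disjoint finite_lattice_paths Int_Un_distrib)
  qed
  finally show ?thesis
    using assms by (simp add: path_count_def of_nat_diff add.commute)
qed

end

theory Submission
  imports Defs
begin

text \<open>
  Polynomials in \<open>\<Delta>\<close> form a commutative ring acting linearly on sequences.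
  Write \<open>c\<^sub>y\<close> for the sequence of path counts to row \<open>y\<close>. From column 1 on,
  \<open>\<Delta> c\<^sub>y = c\<^sub>y\<^sub>-\<^sub>1 + c\<^sub>y\<^sub>+\<^sub>1\<close>, which is the recurrence of the multipliers read downwards from the
  middle row \<open>k\<close>. The reflection \<open>c\<^sub>y = c\<^sub>m\<^sub>+\<^sub>1\<^sub>-\<^sub>y\<close> supplies the start:
  \<open>\<Delta> c\<^sub>k\<close> is \<open>2 c\<^sub>k\<^sub>-\<^sub>1\<close> if \<open>m\<close> is odd and \<open>c\<^sub>k + c\<^sub>k\<^sub>-\<^sub>1\<close> if \<open>m\<close> is even. Hence, with \<open>M\<^sub>j\<close>
  the \<open>j\<close>th multiplier and \<open>\<mu> = M\<^sub>0\<close>, we have \<open>M\<^sub>j c\<^sub>k = \<mu> c\<^sub>k\<^sub>-\<^sub>j\<close>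
  (\<open>multiplier_action_middle\<close>): the middle row determines all the others.

  Folding the column sum \<open>I\<close> along the middle row and applying this to each term gives
  \<open>\<mu> I = 2 S c\<^sub>k\<close> with \<open>S = M\<^sub>1 + \<dots> + M\<^sub>k\<^sub>-\<^sub>1 + 1\<close> (\<open>column_sum_middle\<close>). Applying \<open>M\<^sub>k\<^sub>-\<^sub>a\<close>,
  which commutes with \<open>S\<close>, turns the right-hand side into \<open>2 \<mu> S c\<^sub>a\<close>, and \<open>\<mu>\<close> cancels.
\<close>

section \<open>Polynomials in the difference operator\<close>

lemma diff_action_eq_sum:
  assumes "degree p \<le> N"
  shows "diff_action p a n = (\<Sum>i\<le>N. coeff p i * (forward_diff ^^ i) a n)"
  unfolding diff_action_def
  by (rule sum.mono_neutral_left) (use assms in \<open>auto simp: coeff_eq_0\<close>)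

lemma diff_action_0 [simp]: "diff_action 0 a n = 0"
  by (simp add: diff_action_def)

lemma diff_action_1 [simp]: "diff_action 1 a n = a n"
  by (simp add: diff_action_def)

lemma diff_action_pCons:
  "diff_action (pCons c p) a n = c * a n + diff_action p (forward_diff a) n"
proof -
  have "diff_action (pCons c p) a n =
      (\<Sum>i\<le>Suc (degree p). coeff (pCons c p) i * (forward_diff ^^ i) a n)"
    by (rule diff_action_eq_sum) (rule degree_pCons_le)
  also have "\<dots> = c * a n + diff_action p (forward_diff a) n"
    by (simp add: sum.atMost_Suc_shift diff_action_def funpow_swap1 del: sum.atMost_Suc)
  finally show ?thesis .
qed

lemma diff_action_add:
  "diff_action (p + q) a n = diff_action p a n + diff_action q a n"
  by (subst (1 2 3) diff_action_eq_sum[where N = "max (degree p) (degree q)"])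
    (auto simp: degree_add_le sum.distrib algebra_simps)

lemma diff_action_smult: "diff_action (smult c p) a n = c * diff_action p a n"
  by (induction p arbitrary: a) (simp_all add: diff_action_pCons algebra_simps)

lemma diff_action_diff:
  "diff_action (p - q) a n = diff_action p a n - diff_action q a n"
  using diff_action_add[of "p - q" q a n] by simp

lemma diff_action_sum:
  "diff_action (\<Sum>i\<in>A. p i) a n = (\<Sum>i\<in>A. diff_action (p i) a n)"
  by (induction A rule: infinite_finite_induct) (simp_all add: diff_action_add)

lemma forward_diff_diff_action:
  "forward_diff (diff_action p a) = diff_action p (forward_diff a)"
proof (induction p arbitrary: a)
  case 0
  then show ?case by (simp add: forward_diff_def fun_eq_iff)
next
  case (pCons c p)
  have "forward_diff (diff_action (pCons c p) a) n =
      c * forward_diff a n + forward_diff (diff_action p (forward_diff a)) n" for n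
    unfolding forward_diff_def[of "diff_action _ _"] diff_action_pCons
    by (simp add: forward_diff_def[of a n] algebra_simps)
  then have "forward_diff (diff_action (pCons c p) a) n =
      diff_action (pCons c p) (forward_diff a) n" for n
    unfolding pCons.IH diff_action_pCons[of _ _ "forward_diff a"] .
  then show ?case by blast
qed

lemma diff_action_mult: "diff_action (p * q) a n = diff_action p (diff_action q a) n"
proof (induction p arbitrary: a)
  case (pCons c p)
  then show ?case
    by (simp add: mult_pCons_left diff_action_add diff_action_smult diff_action_pCons
        forward_diff_diff_action)
qed simp

lemma diff_action_scale: "diff_action p (\<lambda>j. c * a j) n = c * diff_action p a n"
proof (induction p arbitrary: a)
  case (pCons d p)
  have "forward_diff (\<lambda>j. c * a j) = (\<lambda>j. c * forward_diff a j)"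
    by (simp add: fun_eq_iff forward_diff_def right_diff_distrib)
  then show ?case by (simp add: diff_action_pCons pCons.IH algebra_simps)
qed simp

text \<open>The action at \<open>n\<close> only looks at terms from index \<open>n\<close> on. The recurrence for the path counts
  fails at column 0, where all counts vanish, so identities valid only from column 1 on have to
  be substituted inside an action.\<close>

lemma diff_action_cong:
  assumes "\<And>j. j \<ge> n \<Longrightarrow> a j = b j"
  shows "diff_action p a n = diff_action p b n"
  using assms
proof (induction p arbitrary: a b)
  case (pCons c p)
  have "diff_action p (forward_diff a) n = diff_action p (forward_diff b) n"
    by (rule pCons.IH) (simp add: forward_diff_def pCons.prems)
  then show ?case by (simp add: diff_action_pCons pCons.prems)
qed simp

section \<open>Path counts and the middle row\<close>

text \<open>Reflection of the table in its horizontal axis.\<close>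

lemma path_count_reflect:
  assumes "y \<le> Suc m" and "x \<ge> 1"
  shows "path_count m x (Suc m - y) = path_count m x y"
  using assms(2,1)
proof (induction x arbitrary: y rule: dec_induct)
  case base
  show ?case
  proof (cases "y = 0 \<or> y = Suc m")
    case False
    then have "1 \<le> y" "y \<le> m" "1 \<le> Suc m - y" "Suc m - y \<le> m"
      using base by auto
    then show ?thesis by (simp only: path_count_1 One_nat_def)
  qed auto
next
  case (step x)
  show ?case
  proof (cases "y = 0 \<or> y = Suc m")
    case False
    then have y: "1 \<le> y" "y \<le> m" using step.prems by auto
    have "path_count m x (Suc m - y - 1) = path_count m x (y + 1)"
      "path_count m x (Suc m - y + 1) = path_count m x (y - 1)"
      using step.IH[of "y + 1"] step.IH[of "y - 1"] y by (auto simp: Suc_diff_le)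
    then show ?thesis
      using step.IH[of y] step.hyps y
      by (simp add: path_count_Suc[of x y] path_count_Suc[of x "Suc m - y"])
  qed auto
qed

lemma forward_diff_path_count:
  assumes "1 \<le> x" and "1 \<le> y" and "y \<le> m"
  shows "forward_diff (\<lambda>j. of_nat (path_count m j y)) x =
    of_nat (path_count m x (y - 1)) + of_nat (path_count m x (y + 1))"
  using assms by (simp add: forward_diff_def path_count_Suc)

lemma multiplier0_nonzero: "multiplier0 m \<noteq> 0"
  by (simp add: multiplier0_def)

text \<open>Row \<open>k\<close> is the middle row for odd \<open>m\<close> and the lower-numbered of the two middle rows for
  even \<open>m\<close>. Up to the factor \<open>M\<^sub>0\<close>, the multiplier \<open>M\<^sub>j\<close> takes it to row \<open>k - j\<close>. At \<open>j = k\<close> this reaches row 0, where all counts vanish.\<close>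

lemma multiplier_action_middle:
  assumes k: "k = (m + 1) div 2" and m: "m \<ge> 1" and "j \<le> k" and "n \<ge> 1"
  shows "diff_action (multiplier m j) (\<lambda>i. of_nat (path_count m i k)) n =
    multiplier0 m * of_nat (path_count m n (k - j))"
  using \<open>j \<le> k\<close> \<open>n \<ge> 1\<close>
proof (induction j arbitrary: n rule: induct_nat_012)
  case 0
  then show ?case by (simp add: diff_action_pCons)
next
  case 1
  have k1: "1 \<le> k" "k \<le> m" using k m by auto
  have "forward_diff (\<lambda>i. of_nat (path_count m i k)) n =
      of_nat (path_count m n (k - 1)) + of_nat (path_count m n (k + 1))"
    using 1 k1 by (intro forward_diff_path_count)
  moreover have "path_count m n (k + 1) =
      (if odd m then path_count m n (k - 1) else path_count m n k)"
  proof (cases "odd m")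
    case True
    then have "Suc m - (k - 1) = k + 1" using k k1 by presburger
    then show ?thesis using path_count_reflect[of "k - 1" m n] True 1 k1 by simp
  next
    case False
    then have "Suc m - k = k + 1" using k k1 by presburger
    then show ?thesis using path_count_reflect[of k m n] False 1 k1 by simp
  qed
  moreover have "multiplier m (Suc 0) = [:multiplier0 m - 2, 1:]"
    by (simp add: numeral_poly)
  ultimately show ?case
    by (simp add: diff_action_pCons multiplier0_def)
next
  case (ge2 j)
  let ?c = "\<lambda>i y. of_nat (path_count m i y) :: rat"
  let ?y = "k - Suc j"
  have y: "1 \<le> ?y" "?y \<le> m" "?y - 1 = k - Suc (Suc j)" "?y + 1 = k - j"
    using ge2.prems k by auto
  have "diff_action (multiplier m (Suc j)) (\<lambda>i. ?c i k) i = multiplier0 m * ?c i ?y"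
    if "i \<ge> n" for i
    using ge2 that by simp
  then have "diff_action [:0, 1:] (diff_action (multiplier m (Suc j)) (\<lambda>i. ?c i k)) n =
      diff_action [:0, 1:] (\<lambda>i. multiplier0 m * ?c i ?y) n"
    by (rule diff_action_cong)
  also have "\<dots> = multiplier0 m * forward_diff (\<lambda>i. ?c i ?y) n"
    by (simp add: diff_action_scale diff_action_pCons)
  also have "\<dots> = multiplier0 m * (?c n (k - Suc (Suc j)) + ?c n (k - j))"
    using forward_diff_path_count[OF ge2.prems(2) y(1,2)] y(3,4) by simp
  finally have "diff_action ([:0, 1:] * multiplier m (Suc j)) (\<lambda>i. ?c i k) n =
      multiplier0 m * (?c n (k - Suc (Suc j)) + ?c n (k - j))"
    by (simp only: diff_action_mult)
  moreover have "diff_action (multiplier m j) (\<lambda>i. ?c i k) n = multiplier0 m * ?c n (k - j)"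
    using ge2 by simp
  ultimately show ?case
    by (simp only: multiplier.simps diff_action_diff) (simp add: algebra_simps)
qed

text \<open>The two halves of the table contribute equally. In the odd case the middle row is its
  own mirror image; the factor \<open>M\<^sub>0\<close> makes the formula uniform in the parity.\<close>

lemma column_sum_fold:
  assumes k: "k = (m + 1) div 2" and m: "m \<ge> 1" and n: "n \<ge> 1"
  shows "multiplier0 m * of_nat (column_sum m n) =
    2 * (multiplier0 m * (\<Sum>y = 1..k - 1. of_nat (path_count m n y)) + of_nat (path_count m n k))"
proof -
  let ?c = "path_count m n"
  have km: "1 \<le> k" "k \<le> m" using k m by auto
  have lower: "(\<Sum>y = 1..k. ?c y) = (\<Sum>y = 1..k - 1. ?c y) + ?c k"
    using km by (cases k) auto
  have "(\<Sum>y = Suc k..m. ?c y) = (\<Sum>y = 1..m - k. ?c (Suc m - y))"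
    using km by (intro sum.reindex_bij_witness[where i = "\<lambda>y. Suc m - y" and j = "\<lambda>y. Suc m - y"]) auto
  also have "\<dots> = (\<Sum>y = 1..m - k. ?c y)"
    using n by (intro sum.cong) (auto simp: path_count_reflect)
  finally have upper: "(\<Sum>y = Suc k..m. ?c y) = (\<Sum>y = 1..m - k. ?c y)" .
  have "column_sum m n = (\<Sum>y = 1..k. ?c y) + (\<Sum>y = Suc k..m. ?c y)"
    unfolding column_sum_def using km
    by (subst sum.union_disjoint[symmetric]) (auto intro!: sum.cong)
  then have total: "column_sum m n = (\<Sum>y = 1..k - 1. ?c y) + ?c k + (\<Sum>y = 1..m - k. ?c y)"
    by (simp only: lower upper)
  show ?thesis
  proof (cases "odd m")
    case True
    then have "m - k = k - 1" using k by presburger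
    then show ?thesis using total True by (simp add: multiplier0_def)
  next
    case False
    then have "m - k = k" using k by presburger
    then show ?thesis using total False lower by (simp add: multiplier0_def)
  qed
qed

lemma column_sum_middle:
  assumes k: "k = (m + 1) div 2" and m: "m \<ge> 1" and n: "n \<ge> 1"
  shows "multiplier0 m * of_nat (column_sum m n) =
    2 * diff_action ((\<Sum>i = 1..k - 1. multiplier m i) + 1) (\<lambda>j. of_nat (path_count m j k)) n"
proof -
  let ?c = "\<lambda>y. of_nat (path_count m n y) :: rat"
  have "(\<Sum>i = 1..k - 1. diff_action (multiplier m i) (\<lambda>j. of_nat (path_count m j k)) n) =
      (\<Sum>i = 1..k - 1. multiplier0 m * ?c (k - i))"
    using n by (intro sum.cong) (auto simp: multiplier_action_middle[OF k m])
  also have "\<dots> = multiplier0 m * (\<Sum>y = 1..k - 1. ?c y)"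
    unfolding sum_distrib_left
    by (intro sum.reindex_bij_witness[where i = "\<lambda>y. k - y" and j = "\<lambda>y. k - y"]) auto
  finally show ?thesis
    by (simp add: column_sum_fold[OF k m n] diff_action_add diff_action_sum)
qed

section \<open>The column sum from a single row\<close>

theorem corollary2p3:
  fixes m k :: nat
  assumes "m \<ge> 1" and "k = nat \<lceil>real m / 2\<rceil>"
  shows "(\<forall>a \<in> {1..k}. \<forall>n \<ge> 1.
            diff_action (multiplier m (k - a)) (\<lambda>j. of_nat (column_sum m j)) n =
            2 * diff_action ((\<Sum>i = 1..k - 1. multiplier m i) + 1)
                  (\<lambda>j. of_nat (path_count m j a)) n) \<and>
         (\<forall>n \<ge> 1.
            of_nat (column_sum m n) =
            2 / multiplier0 m *
              diff_action ((\<Sum>i = 1..k - 1. multiplier m i) + 1)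
                (\<lambda>j. of_nat (path_count m j k)) n)"
proof -
  have k: "k = (m + 1) div 2"
  proof -
    have "real (2 * ((m + 1) div 2)) \<ge> real m" "real (2 * ((m + 1) div 2)) < real (m + 2)"
      unfolding of_nat_le_iff of_nat_less_iff by presburger+
    then have "\<lceil>real m / 2\<rceil> = int ((m + 1) div 2)"
      by (intro ceiling_unique) simp_all
    then show ?thesis using assms(2) by simp
  qed
  note m = \<open>m \<ge> 1\<close>
  let ?S = "(\<Sum>i = 1..k - 1. multiplier m i) + 1"
  let ?\<mu> = "multiplier0 m"
  let ?c = "\<lambda>y j. of_nat (path_count m j y) :: rat"
  let ?I = "\<lambda>j. of_nat (column_sum m j) :: rat"
  have "diff_action (multiplier m (k - a)) ?I n = 2 * diff_action ?S (?c a) n"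
    if a: "a \<in> {1..k}" and n: "n \<ge> 1" for a n
  proof -
    let ?M = "multiplier m (k - a)"
    have "?\<mu> * diff_action ?M ?I n = diff_action ?M (\<lambda>j. ?\<mu> * ?I j) n"
      by (simp only: diff_action_scale)
    also have "\<dots> = diff_action ?M (\<lambda>j. 2 * diff_action ?S (?c k) j) n"
      by (rule diff_action_cong) (use n in \<open>simp only: column_sum_middle[OF k m]\<close>)
    also have "\<dots> = 2 * diff_action ?S (diff_action ?M (?c k)) n"
      by (simp only: diff_action_scale diff_action_mult[symmetric] mult.commute[of ?M])
    also have "diff_action ?S (diff_action ?M (?c k)) n = diff_action ?S (\<lambda>j. ?\<mu> * ?c a j) n"
      by (rule diff_action_cong) (use a n in \<open>simp add: multiplier_action_middle[OF k m]\<close>)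
    also have "2 * \<dots> = ?\<mu> * (2 * diff_action ?S (?c a) n)"
      by (simp only: diff_action_scale mult.left_commute)
    finally show ?thesis
      using multiplier0_nonzero by simp
  qed
  moreover have "?I n = 2 / ?\<mu> * diff_action ?S (?c k) n" if "n \<ge> 1" for n
    using column_sum_middle[OF k m that] multiplier0_nonzero[of m] by (simp add: field_simps)
  ultimately show ?thesis by blast
qed

end
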